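(* Let $n\ge1$ be an integer. Let $g\in C(\mathbb{R})$ be a bounded function satisfying $$u\,g(u)>0\ \text{ for all } u\in\mathbb{R}\setminus\{0\},\qquad \liminf_{u\to\infty}g(u)>0,\qquad \limsup_{u\to-\infty}g(u)<0 .$$ Let $e\in C(\mathbb{R})$ be a $2\pi$-periodic function satisfying $$\int_0^{2\pi}e(t)\sin nt\,dt=\int_0^{2\pi}e(t)\cos nt\,dt=0 .$$ Then the equation $$u''+n^2u+g(u)=e(t)$$ has a $2\pi$-periodic solution $u=u(t)$.
   Context: All functions are real-valued. *)

theory Defs
  imports "HOL-Analysis.Analysis" "HOL-Library.Periodic_Fun"
begin

end

theory Submission
  imports Defs "HOL-Complex_Analysis.Great_Picard"
begin

text \<open>
  Write \<open>w(t) = exp(i n t)\<close> and \<open>u = \<langle>z, w\<rangle>\<close> with complex \<open>z\<close>; variation of constants turns the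
  equation into \<open>z' = F(t, z) = (e - g(\<langle>z, w\<rangle>)) i w / n\<close> with bounded \<open>F\<close>. Over one period every
  path stays within a fixed distance of its start \<open>x\<close>, and by orthogonality of \<open>e\<close>
  to \<open>w\<close> the displacement \<open>D\<close> satisfies \<open>n \<langle>i D, x\<rangle> = \<integral> g(\<langle>z, w\<rangle>) \<langle>x, w\<rangle>\<close>, which the sign of \<open>g\<close> near
  infinity makes positive on a large circle \<open>|x| = R\<close>. Brouwer's theorem then gives a zero of \<open>D\<close>.
  As \<open>g\<close> is merely continuous, \<open>D\<close> is not a function of \<open>x\<close>; the argument is therefore
  carried out for the delay equations \<open>z'(t) = F(t, z(t - d))\<close>, which have unique solutions depending
  continuously on \<open>x\<close>, and \<open>d \<rightarrow> 0\<close> by Arzela--Ascoli.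
\<close>

section \<open>Zeros of outward-pointing vector fields\<close>

text \<open>If \<open>V\<close> had no zero, the map sending \<open>x\<close> to the vector of
  length \<open>R\<close> opposite to \<open>V x\<close> would be continuous from the ball to its
  sphere. A Brouwer fixed point of it has norm \<open>R\<close> and is a negative multiple of
  \<open>V x\<close>, against \<open>out\<close>.\<close>

lemma outward_field_has_zero:
  fixes V :: "'a::euclidean_space \<Rightarrow> 'a"
  assumes R: "R > 0" and cont: "continuous_on (cball 0 R) V"
    and out: "\<And>x. norm x = R \<Longrightarrow> inner (V x) x > 0"
  obtains x where "norm x \<le> R" "V x = 0"
proof (rule ccontr)
  assume "\<not> thesis"
  then have nz: "V x \<noteq> 0" if "norm x \<le> R" for x
    using that \<open>\<And>x. \<lbrakk>norm x \<le> R; V x = 0\<rbrakk> \<Longrightarrow> thesis\<close> by blast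
  let ?f = "\<lambda>x. - (R / norm (V x)) *\<^sub>R V x"
  have nf: "norm (?f x) = R" if "norm x \<le> R" for x
    using nz[OF that] R by simp
  have "continuous_on (cball 0 R) ?f"
    by (intro continuous_intros cont) (use nz in auto)
  moreover have "?f \<in> cball 0 R \<rightarrow> cball 0 R"
    using nf by auto
  ultimately obtain x where x: "x \<in> cball 0 R" "?f x = x"
    using brouwer_ball[OF R] by blast
  have nx: "norm x \<le> R" using x(1) by simp
  have "inner (V x) x = inner (V x) (?f x)" using x(2) by simp
  also have "\<dots> = - (R / norm (V x)) * inner (V x) (V x)" by simp
  also have "\<dots> \<le> 0" using R by (simp add: mult_nonneg_nonneg)
  finally show False using out[of x] nf[OF nx] unfolding x(2) by simp
qed

section \<open>Delay equations and their dependence on the initial value\<close>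

text \<open>The integral over \<open>[0, t]\<close> is rescaled to \<open>[0, 1]\<close>, so that joint continuity in \<open>x\<close>
  and \<open>t\<close> follows from the continuity of integrals depending on a parameter.\<close>

primrec delay_iterate ::
  "(real \<Rightarrow> 'a \<Rightarrow> 'a) \<Rightarrow> real \<Rightarrow> nat \<Rightarrow> 'a::euclidean_space \<Rightarrow> real \<Rightarrow> 'a" where
  "delay_iterate F d 0 x t = x"
| "delay_iterate F d (Suc j) x t =
     x + integral {0..1} (\<lambda>r. t *\<^sub>R F (t * r) (delay_iterate F d j x (max 0 (t * r - d))))"

lemma continuous_on_delay_iterate:
  assumes F: "continuous_on UNIV (\<lambda>(t, z). F t z)"
  shows "continuous_on UNIV (\<lambda>(x, t). delay_iterate F d j x t)"
proof (induction j)
  case 0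
  then show ?case by (simp add: case_prod_unfold continuous_on_fst continuous_on_id)
next
  case (Suc j)
  let ?G = "\<lambda>(p::'a \<times> real) r.
    snd p *\<^sub>R F (snd p * r) (delay_iterate F d j (fst p) (max 0 (snd p * r - d)))"
  have "continuous_on (UNIV \<times> cbox 0 1) (\<lambda>(p, r). ?G p r)"
    unfolding case_prod_unfold
    by (intro continuous_intros
          continuous_on_compose2[OF F[unfolded case_prod_unfold], where f = "\<lambda>x. (_ x, _ x)", simplified]
          continuous_on_compose2[OF Suc[unfolded case_prod_unfold], where f = "\<lambda>x. (_ x, _ x)", simplified])
  then have "continuous_on UNIV (\<lambda>p. integral (cbox 0 1) (?G p))"
    by (rule integral_continuous_on_param)
  then have "continuous_on UNIV (\<lambda>p. fst p + integral {0..1} (?G p))"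
    by (intro continuous_intros) simp
  then show ?case by (simp add: case_prod_unfold)
qed

lemma integral_rescale_unit:
  fixes f :: "real \<Rightarrow> 'a::euclidean_space"
  assumes "continuous_on {0..t} f" "0 \<le> t"
  shows "integral {0..1} (\<lambda>r. t *\<^sub>R f (t * r)) = integral {0..t} f"
proof -
  have "((\<lambda>r. t *\<^sub>R f (t * r)) has_integral integral {t * 0..t * 1} f) {0..1}"
    by (rule has_integral_substitution[where c = 0 and d = t])
       (use assms in \<open>auto intro!: derivative_eq_intros mult_left_le\<close>)
  then show ?thesis by (metis integral_unique mult_zero_right mult_1_right)
qed

text \<open>Method of steps: the right-hand side at time \<open>s\<close> looks back to
  \<open>max 0 (s - d)\<close>, so each iteration makes the solution exact on one more interval of
  length \<open>d\<close>. A single iterate therefore solves the equation on all of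
  \<open>{0..T}\<close> for every \<open>x\<close> at once, and inherits its joint
  continuity.\<close>

lemma delay_equation_solution:
  fixes F :: "real \<Rightarrow> 'a::euclidean_space \<Rightarrow> 'a"
  assumes F: "continuous_on UNIV (\<lambda>(t, z). F t z)" and d: "d > 0"
  obtains Z where "continuous_on UNIV (\<lambda>(x, t). Z x t)"
    "\<And>x t. t \<in> {0..T} \<Longrightarrow> Z x t = x + integral {0..t} (\<lambda>s. F s (Z x (max 0 (s - d))))"
proof -
  let ?Z = "delay_iterate F d"
  have cont_t: "continuous_on S (?Z j x)" for S j x
    using continuous_on_compose2[OF continuous_on_delay_iterate[OF F], of S "Pair x" d j]
    by (simp add: continuous_intros)
  have Suc_eq: "?Z (Suc j) x t = x + integral {0..t} (\<lambda>s. F s (?Z j x (max 0 (s - d))))"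
    if "0 \<le> t" for j x t
  proof -
    have "continuous_on {0..t} (\<lambda>s. F s (?Z j x (max 0 (s - d))))"
      by (intro continuous_on_compose2[OF F, where f = "\<lambda>s. (s, _ s)", simplified] continuous_intros
            continuous_on_compose2[OF cont_t[of UNIV]]) auto
    then show ?thesis using integral_rescale_unit[OF _ that] by simp
  qed
  \<comment> \<open>For \<open>s\<close> up to \<open>(j + 1) * d\<close> the delayed time is at
    most \<open>j * d\<close>, which is where the induction hypothesis applies. The base case only
    concerns \<open>t = 0\<close>.\<close>
  have stable: "?Z (Suc j) x t = ?Z j x t" if "0 \<le> t" "t \<le> real j * d" for j x t
    using that
  proof (induction j arbitrary: t)
    case 0
    then show ?case by simp
  next
    case (Suc j)
    have "?Z (Suc j) x (max 0 (s - d)) = ?Z j x (max 0 (s - d))" if "s \<in> {0..t}" for s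
      by (rule Suc.IH) (use that Suc.prems d in \<open>auto simp: algebra_simps\<close>)
    then show ?case
      unfolding Suc_eq[OF Suc.prems(1)] by (metis (no_types, lifting) integral_cong)
  qed
  obtain j :: nat where "T / d \<le> real j" using real_arch_simple by blast
  then have j: "T \<le> real j * d" using d by (simp add: field_simps)
  show thesis
  proof
    show "continuous_on UNIV (\<lambda>(x, t). ?Z j x t)"
      by (rule continuous_on_delay_iterate[OF F])
    show "?Z j x t = x + integral {0..t} (\<lambda>s. F s (?Z j x (max 0 (s - d))))"
      if "t \<in> {0..T}" for x t
      using stable[of t j x] Suc_eq[of t j x] that j by simp
  qed
qed

section \<open>Boundary value problem on one period\<close>

lemma integral_function_lipschitz:
  fixes f :: "real \<Rightarrow> 'a::euclidean_space"
  assumes z: "\<And>t. t \<in> {0..T} \<Longrightarrow> z t = x + integral {0..t} f"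
    and f: "continuous_on {0..T} f" and C: "\<And>t. t \<in> {0..T} \<Longrightarrow> norm (f t) \<le> C"
    and "a \<in> {0..T}" "b \<in> {0..T}"
  shows "norm (z a - z b) \<le> C * \<bar>a - b\<bar>"
proof -
  have *: "norm (z b - z a) \<le> C * (b - a)" if "0 \<le> a" "a \<le> b" "b \<le> T" for a b
  proof -
    have "integral {0..a} f + integral {a..b} f = integral {0..b} f"
      by (rule Henstock_Kurzweil_Integration.integral_combine)
         (use that in \<open>auto intro!: integrable_continuous_real continuous_on_subset[OF f]\<close>)
    then have "z b - z a = integral {a..b} f"
      using z[of a] z[of b] that by (simp add: algebra_simps)
    also have "norm \<dots> \<le> C * (b - a)"
      by (rule integral_bound) (use that in \<open>auto intro!: C continuous_on_subset[OF f]\<close>)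
    finally show ?thesis .
  qed
  show ?thesis
    using *[of a b] *[of b a] assms(4,5) by (cases "a \<le> b") (auto simp: norm_minus_commute)
qed

text \<open>The displacement over \<open>{0..T}\<close> depends continuously on the starting point,
  and \<open>guide\<close> says that its image under \<open>J\<close> points outward on the sphere
  of radius \<open>R\<close>; a zero of this field starts a path that closes up. The linear
  injective \<open>J\<close> allows the displacement itself to point elsewhere, for instance after a
  rotation. The condition \<open>guide\<close> quantifies over all continuous \<open>y\<close> near
  \<open>x\<close>, since the path inserted into \<open>F\<close> is the delayed one.\<close>

lemma delay_boundary_value_solution:
  fixes F :: "real \<Rightarrow> 'a::euclidean_space \<Rightarrow> 'a" and J :: "'a \<Rightarrow> 'a"
  assumes F: "continuous_on UNIV (\<lambda>(t, z). F t z)" and T: "T > 0"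
    and C: "\<And>t z. t \<in> {0..T} \<Longrightarrow> norm (F t z) \<le> C"
    and R: "R > 0" and J: "bounded_linear J" "\<And>v. J v = 0 \<Longrightarrow> v = 0"
    and guide: "\<And>x y. \<lbrakk>norm x = R; continuous_on {0..T} y;
                  \<And>s. s \<in> {0..T} \<Longrightarrow> norm (y s - x) \<le> C * T\<rbrakk>
                \<Longrightarrow> inner (J (integral {0..T} (\<lambda>s. F s (y s)))) x > 0"
    and d: "d > 0"
  obtains z where "continuous_on {0..T} z" "norm (z 0) \<le> R" "z T = z 0"
    "\<And>t. t \<in> {0..T} \<Longrightarrow> z t = z 0 + integral {0..t} (\<lambda>s. F s (z (max 0 (s - d))))"
    "\<And>a b. \<lbrakk>a \<in> {0..T}; b \<in> {0..T}\<rbrakk> \<Longrightarrow> norm (z a - z b) \<le> C * \<bar>a - b\<bar>"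
proof -
  obtain Z where contZ: "continuous_on UNIV (\<lambda>(x, t). Z x t)"
    and Z: "\<And>x t. t \<in> {0..T} \<Longrightarrow> Z x t = x + integral {0..t} (\<lambda>s. F s (Z x (max 0 (s - d))))"
    using delay_equation_solution[OF F d] by metis
  have cont_t: "continuous_on S (Z x)" for S x
    using continuous_on_compose2[OF contZ, of S "Pair x"] by (simp add: continuous_intros)
  have cont_shift: "continuous_on S (\<lambda>s. Z x (max 0 (s - d)))" for S x
    by (intro continuous_on_compose2[OF cont_t[of UNIV]] continuous_intros) auto
  have cont_F: "continuous_on S (\<lambda>s. F s (Z x (max 0 (s - d))))" for S x
    by (intro continuous_on_compose2[OF F, where f = "\<lambda>s. (s, _ s)", simplified] continuous_intros
          cont_shift)
  have Z0: "Z x 0 = x" for x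
    using Z[of 0 x] T by simp
  have lip: "norm (Z x a - Z x b) \<le> C * \<bar>a - b\<bar>" if "a \<in> {0..T}" "b \<in> {0..T}" for x a b
    by (rule integral_function_lipschitz[OF Z cont_F C that])
  have C0: "0 \<le> C" using C[of 0 0] T norm_ge_zero[of "F 0 0"] by (simp del: norm_ge_zero)
  have cont_x: "continuous_on S (\<lambda>x. Z x T)" for S
    using continuous_on_compose2[OF contZ, of S "\<lambda>x. (x, T)"] by (simp add: continuous_intros)
  have "inner (J (Z x T - x)) x > 0" if "norm x = R" for x
  proof -
    \<comment> \<open>The delayed path never leaves times in \<open>{0..T}\<close>, so the Lipschitz
      bound keeps it within \<open>C * T\<close> of the start and \<open>guide\<close> applies to
      it.\<close>
    have "norm (Z x (max 0 (s - d)) - x) \<le> C * T" if "s \<in> {0..T}" for s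
    proof -
      have "norm (Z x (max 0 (s - d)) - Z x 0) \<le> C * \<bar>max 0 (s - d) - 0\<bar>"
        by (rule lip) (use that d in auto)
      also have "\<dots> \<le> C * T"
        using that d C0 by (intro mult_left_mono) auto
      finally show ?thesis by (simp add: Z0)
    qed
    from guide[OF that cont_shift this] show ?thesis
      using Z[of T x] T by simp
  qed
  moreover have "continuous_on (cball 0 R) (\<lambda>x. J (Z x T - x))"
    by (intro bounded_linear.continuous_on[OF J(1)] continuous_intros cont_x)
  ultimately obtain x where x: "norm x \<le> R" "J (Z x T - x) = 0"
    using outward_field_has_zero[OF R, of "\<lambda>x. J (Z x T - x)"] by blast
  show thesis
  proof
    show "continuous_on {0..T} (Z x)" by (rule cont_t)
    show "norm (Z x 0) \<le> R" "Z x T = Z x 0"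
      using x J(2)[OF x(2)] by (auto simp: Z0)
    show "Z x t = Z x 0 + integral {0..t} (\<lambda>s. F s (Z x (max 0 (s - d))))" if "t \<in> {0..T}" for t
      using Z[OF that] by (simp add: Z0)
    show "norm (Z x a - Z x b) \<le> C * \<bar>a - b\<bar>" if "a \<in> {0..T}" "b \<in> {0..T}" for a b
      using lip[OF that] .
  qed
qed

text \<open>The bounds \<open>R\<close> and \<open>C\<close> do not depend on the delay, so the
  closed delay solutions for \<open>d m\<close> tending to 0 are uniformly bounded and share a
  Lipschitz constant. A uniformly convergent subsequence exists, and its limit satisfies the
  equation without delay.\<close>

proposition boundary_value_solution:
  fixes F :: "real \<Rightarrow> 'a::euclidean_space \<Rightarrow> 'a" and J :: "'a \<Rightarrow> 'a"
  assumes F: "continuous_on UNIV (\<lambda>(t, z). F t z)" and T: "T > 0"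
    and C: "\<And>t z. t \<in> {0..T} \<Longrightarrow> norm (F t z) \<le> C"
    and R: "R > 0" and J: "bounded_linear J" "\<And>v. J v = 0 \<Longrightarrow> v = 0"
    and guide: "\<And>x y. \<lbrakk>norm x = R; continuous_on {0..T} y;
                  \<And>s. s \<in> {0..T} \<Longrightarrow> norm (y s - x) \<le> C * T\<rbrakk>
                \<Longrightarrow> inner (J (integral {0..T} (\<lambda>s. F s (y s)))) x > 0"
  obtains z where "continuous_on {0..T} z" "z T = z 0"
    "\<And>t. t \<in> {0..T} \<Longrightarrow> z t = z 0 + integral {0..t} (\<lambda>s. F s (z s))"
proof -
  define d :: "nat \<Rightarrow> real" where "d m = inverse (real (Suc m))" for m
  have d_pos: "d m > 0" for m by (simp add: d_def)
  define solves where "solves m z \<longleftrightarrow> continuous_on {0..T} z \<and> norm (z 0) \<le> R \<and> z T = z 0 \<and>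
      (\<forall>t\<in>{0..T}. z t = z 0 + integral {0..t} (\<lambda>s. F s (z (max 0 (s - d m))))) \<and>
      (\<forall>a\<in>{0..T}. \<forall>b\<in>{0..T}. norm (z a - z b) \<le> C * \<bar>a - b\<bar>)" for m z
  have "\<exists>z. solves m z" for m
  proof (rule delay_boundary_value_solution[of F T C R J "d m"])
    fix z
    assume "continuous_on {0..T} z" "norm (z 0) \<le> R" "z T = z 0"
      "\<And>t. t \<in> {0..T} \<Longrightarrow> z t = z 0 + integral {0..t} (\<lambda>s. F s (z (max 0 (s - d m))))"
      "\<And>a b. \<lbrakk>a \<in> {0..T}; b \<in> {0..T}\<rbrakk> \<Longrightarrow> norm (z a - z b) \<le> C * \<bar>a - b\<bar>"
    then have "solves m z" unfolding solves_def by blast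
    then show "\<exists>z. solves m z" by blast
  qed (fact F T C R J guide d_pos)+
  then obtain z where zs: "\<And>m. solves m (z m)" by metis
  have cont: "\<And>m. continuous_on {0..T} (z m)" and z0: "\<And>m. norm (z m 0) \<le> R"
    and zT: "\<And>m. z m T = z m 0"
    and z: "\<And>m t. t \<in> {0..T} \<Longrightarrow>
              z m t = z m 0 + integral {0..t} (\<lambda>s. F s (z m (max 0 (s - d m))))"
    and lip: "\<And>m a b. \<lbrakk>a \<in> {0..T}; b \<in> {0..T}\<rbrakk> \<Longrightarrow> norm (z m a - z m b) \<le> C * \<bar>a - b\<bar>"
    using zs unfolding solves_def by blast+
  have C0: "0 \<le> C" using C[of 0 0] T norm_ge_zero[of "F 0 0"] by (simp del: norm_ge_zero)
  obtain y k where y: "continuous_on {0..T} y" and k: "strict_mono (k :: nat \<Rightarrow> nat)"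
    and lim: "\<And>e. 0 < e \<Longrightarrow> \<exists>N. \<forall>m t. m \<ge> N \<and> t \<in> {0..T} \<longrightarrow> norm (z (k m) t - y t) < e"
  proof (rule Arzela_Ascoli[of "{0..T}" z "R + C * T"])
    show "norm (z m t) \<le> R + C * T" if "t \<in> {0..T}" for m t
    proof -
      have "norm (z m t - z m 0) \<le> C * \<bar>t - 0\<bar>" using that by (intro lip) auto
      also have "\<dots> \<le> C * T" using that C0 by (intro mult_left_mono) auto
      finally show ?thesis using z0[of m] norm_triangle_sub[of "z m t" "z m 0"] by linarith
    qed
    show "\<exists>r>0. \<forall>m t. t \<in> {0..T} \<and> norm (s - t) < r \<longrightarrow> norm (z m s - z m t) < e"
      if "s \<in> {0..T}" "0 < e" for s e
    \<comment> \<open>Dividing by \<open>C + 1\<close> instead of \<open>C\<close> covers the case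
      \<open>C = 0\<close> and makes the final inequality strict.\<close>
    proof (intro exI[of _ "e / (C + 1)"] conjI allI impI)
      show "e / (C + 1) > 0" using that C0 by simp
      fix m t assume t: "t \<in> {0..T} \<and> norm (s - t) < e / (C + 1)"
      have "norm (z m s - z m t) \<le> C * \<bar>s - t\<bar>" using that t by (intro lip) auto
      also have "\<dots> \<le> C * (e / (C + 1))" using t C0 by (intro mult_left_mono) auto
      also have "\<dots> < e" using that C0 by (simp add: field_simps)
      finally show "norm (z m s - z m t) < e" .
    qed
  qed auto
  have zlim: "(\<lambda>m. z (k m) t) \<longlonglongrightarrow> y t" if "t \<in> {0..T}" for t
    unfolding LIMSEQ_iff using lim that by meson
  have dlim: "(\<lambda>m. d (k m)) \<longlonglongrightarrow> 0"
    using LIMSEQ_subseq_LIMSEQ[OF LIMSEQ_inverse_real_of_nat k] by (simp add: d_def o_def)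
  \<comment> \<open>The delay displaces the argument by at most \<open>d (k m)\<close>, which the
    common Lipschitz constant turns into an error of at most \<open>C * d (k m)\<close>.\<close>
  have shift: "(\<lambda>m. z (k m) (max 0 (t - d (k m)))) \<longlonglongrightarrow> y t" if t: "t \<in> {0..T}" for t
  proof -
    have "(\<lambda>m. z (k m) (max 0 (t - d (k m))) - z (k m) t) \<longlonglongrightarrow> 0"
    proof (rule Lim_null_comparison)
      show "(\<lambda>m. C * d (k m)) \<longlonglongrightarrow> 0" using tendsto_mult_left[OF dlim, of C] by simp
      show "\<forall>\<^sub>F m in sequentially. norm (z (k m) (max 0 (t - d (k m))) - z (k m) t) \<le> C * d (k m)"
      proof (intro always_eventually allI)
        fix m
        have "norm (z (k m) (max 0 (t - d (k m))) - z (k m) t) \<le> C * \<bar>max 0 (t - d (k m)) - t\<bar>"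
          using t d_pos[of "k m"] by (intro lip) auto
        also have "\<dots> \<le> C * d (k m)"
          using t d_pos[of "k m"] C0 by (intro mult_left_mono) auto
        finally show "norm (z (k m) (max 0 (t - d (k m))) - z (k m) t) \<le> C * d (k m)" .
      qed
    qed
    from tendsto_add[OF this zlim[OF t]] show ?thesis by simp
  qed
  show thesis
  proof
    show "continuous_on {0..T} y" by (rule y)
    show "y T = y 0"
      using LIMSEQ_unique[OF zlim[of T], of "y 0"] zlim[of 0] T by (simp add: zT)
    fix t assume t: "t \<in> {0..T}"
    have "(\<lambda>m. integral {0..t} (\<lambda>s. F s (z (k m) (max 0 (s - d (k m))))))
        \<longlonglongrightarrow> integral {0..t} (\<lambda>s. F s (y s))"
    \<comment> \<open>The integrands converge pointwise by continuity of \<open>F\<close> and are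
      dominated by the constant \<open>C\<close>.\<close>
    proof (rule dominated_convergence(2))
      show "(\<lambda>s. F s (z (k m) (max 0 (s - d (k m))))) integrable_on {0..t}" for m
        by (intro integrable_continuous_real
              continuous_on_compose2[OF F, where f = "\<lambda>s. (s, _ s)", simplified]
              continuous_intros continuous_on_compose2[OF cont])
           (use t d_pos[of "k m"] in auto)
      show "(\<lambda>_. C) integrable_on {0..t}" by (intro integrable_continuous_real continuous_intros)
      show "norm (F s (z (k m) (max 0 (s - d (k m))))) \<le> C" if "s \<in> {0..t}" for m s
        using that t by (intro C) auto
      show "(\<lambda>m. F s (z (k m) (max 0 (s - d (k m))))) \<longlonglongrightarrow> F s (y s)" if "s \<in> {0..t}" for s
      proof -
        have "(\<lambda>m. (s, z (k m) (max 0 (s - d (k m))))) \<longlonglongrightarrow> (s, y s)"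
          using that t by (intro tendsto_Pair tendsto_const shift) auto
        from continuous_on_tendsto_compose[OF F this] show ?thesis by simp
      qed
    qed
    from tendsto_add[OF zlim[of 0] this] have
      "(\<lambda>m. z (k m) t) \<longlonglongrightarrow> y 0 + integral {0..t} (\<lambda>s. F s (y s))"
      using T by (simp flip: z[OF t])
    then show "y t = y 0 + integral {0..t} (\<lambda>s. F s (y s))"
      using LIMSEQ_unique[OF zlim[OF t]] by blast
  qed
qed

section \<open>Periodic extension of a closed solution\<close>

text \<open>Used to glue the left and right derivatives where two copies of the period interval
  meet.\<close>

lemma has_vector_derivative_within_Un:
  assumes "(f has_vector_derivative D) (at x within S)" "(f has_vector_derivative D) (at x within T)"
  shows "(f has_vector_derivative D) (at x within (S \<union> T))"
  using assms unfolding has_vector_derivative_def has_derivative_within by (auto intro: Lim_Un)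

text \<open>Translates of \<open>z\<close> agree at multiples of \<open>T\<close> because
  \<open>z T = z 0\<close>. The periodicity of \<open>F\<close> makes each translate a solution and
  makes the two one-sided derivatives at a junction equal.\<close>

lemma periodic_extension_of_solution:
  fixes F :: "real \<Rightarrow> 'a::real_normed_vector \<Rightarrow> 'a"
  assumes T: "T > 0" and per: "\<And>t. F (t + T) = F t" and zT: "z T = z 0"
    and der: "\<And>t. t \<in> {0..T} \<Longrightarrow> (z has_vector_derivative F t (z t)) (at t within {0..T})"
  obtains Z where "\<And>t. (Z has_vector_derivative F t (Z t)) (at t)" "\<And>t. Z (t + T) = Z t"
proof -
  interpret F: periodic_fun_simple F T by standard (rule per)
  define Z where "Z t = z (t - of_int \<lfloor>t / T\<rfloor> * T)" for t
  define I where "I k = {of_int k * T..of_int (k + 1) * T}" for k :: int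
  \<comment> \<open>The intervals \<open>I k\<close> are closed. At the right endpoint the floor is
    already \<open>k + 1\<close>, so there the formula rests on \<open>zT\<close>.\<close>
  have Z_eq: "Z t = z (t - of_int k * T)" if "t \<in> I k" for t k
  proof (cases "t = of_int (k + 1) * T")
    case True
    then have "t / T = of_int (k + 1)" using T by simp
    then have "\<lfloor>t / T\<rfloor> = k + 1" by (simp only: floor_of_int)
    with True zT show ?thesis by (simp add: Z_def algebra_simps)
  next
    case False
    with that have "of_int k * T \<le> t" "t < of_int (k + 1) * T" by (auto simp: I_def)
    then have "\<lfloor>t / T\<rfloor> = k" using T by (intro floor_unique) (auto simp: field_simps)
    then show ?thesis by (simp add: Z_def)
  qed
  have der_I: "(Z has_vector_derivative F t (Z t)) (at t within I k)" if t: "t \<in> I k" for t k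
  proof -
    let ?s = "\<lambda>t. t - of_int k * T"
    have img: "?s ` I k = {0..T}"
      by (auto simp: I_def algebra_simps image_iff intro!: bexI[of _ "_ + of_int k * T"])
    have "?s t \<in> {0..T}" using t by (auto simp: I_def algebra_simps)
    from der[OF this] have "(z has_vector_derivative F t (z (?s t))) (at (?s t) within ?s ` I k)"
      using F.minus_of_int[of t k] by (simp only: img)
    moreover have "(?s has_vector_derivative 1) (at t within I k)"
      by (auto intro!: derivative_eq_intros)
    ultimately have "(z \<circ> ?s has_vector_derivative 1 *\<^sub>R F t (z (?s t))) (at t within I k)"
      by (rule vector_diff_chain_within[rotated])
    then have "(z \<circ> ?s has_vector_derivative F t (Z t)) (at t within I k)"
      by (simp add: Z_eq[OF t])
    then show ?thesis
      by (rule has_vector_derivative_transform[OF t, rotated]) (simp add: Z_eq)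
  qed
  show thesis
  proof
    show "Z (t + T) = Z t" for t
    proof -
      have "(t + T) / T = t / T + 1" using T by (simp add: field_simps)
      then show ?thesis by (simp add: Z_def algebra_simps)
    qed
    fix t
    define k where "k = \<lfloor>t / T\<rfloor>"
    have "of_int k \<le> t / T" "t / T < of_int k + 1" unfolding k_def by linarith+
    then have k: "of_int k * T \<le> t" "t < of_int (k + 1) * T" using T by (auto simp: field_simps)
    show "(Z has_vector_derivative F t (Z t)) (at t)"
    \<comment> \<open>At a multiple of \<open>T\<close> only the union of two adjacent intervals is
      a neighbourhood of \<open>t\<close>; elsewhere \<open>I k\<close> is one.\<close>
    proof (cases "t = of_int k * T")
      case True
      have "t \<in> I k" "t \<in> I (k - 1)" using k T True by (auto simp: I_def algebra_simps)
      then have "(Z has_vector_derivative F t (Z t)) (at t within I (k - 1) \<union> I k)"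
        by (intro has_vector_derivative_within_Un der_I)
      moreover have "t \<in> interior (I (k - 1) \<union> I k)"
      proof (rule interiorI)
        show "open {of_int (k - 1) * T<..<of_int (k + 1) * T}" by simp
      qed (use True T in \<open>auto simp: I_def algebra_simps\<close>)
      ultimately show ?thesis by (metis at_within_interior)
    next
      case False
      with k have "t \<in> I k" "t \<in> interior (I k)" by (auto simp: I_def)
      with der_I[of t k] show ?thesis by (metis at_within_interior)
    qed
  qed
qed

section \<open>Integral and pointwise estimates for the outward condition\<close>

text \<open>By the double-angle formulas the square is its mean \<open>(norm x)\<^sup>2 / 2\<close>
  plus terms of frequency \<open>2 * n\<close>, which integrate to zero over the period;
  \<open>A\<close> is the resulting antiderivative.\<close>

lemma has_integral_sinusoid_square:
  assumes n: "n \<ge> 1"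
  shows "((\<lambda>s. (x \<bullet> cis (real n * s))\<^sup>2) has_integral pi * (norm x)\<^sup>2) {0..2 * pi}"
proof -
  define a b where "a = Re x" "b = Im x"
  define A where "A s = (a\<^sup>2 + b\<^sup>2) / 2 * s + (a\<^sup>2 - b\<^sup>2) / (4 * real n) * sin (2 * (real n * s))
      - a * b / (2 * real n) * cos (2 * (real n * s))" for s
  have "(A has_vector_derivative (x \<bullet> cis (real n * s))\<^sup>2) (at s within {0..2 * pi})" for s
  proof -
    have "(A has_real_derivative (a\<^sup>2 + b\<^sup>2) / 2 + (a\<^sup>2 - b\<^sup>2) / 2 * cos (2 * (real n * s))
        + a * b * sin (2 * (real n * s))) (at s within {0..2 * pi})"
      unfolding A_def by (rule derivative_eq_intros refl | use n in \<open>simp add: field_simps\<close>)+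
    also have "(a\<^sup>2 + b\<^sup>2) / 2 + (a\<^sup>2 - b\<^sup>2) / 2 * cos (2 * (real n * s)) + a * b * sin (2 * (real n * s))
        = (x \<bullet> cis (real n * s))\<^sup>2"
    proof -
      define C S where "C = cos (real n * s)" "S = sin (real n * s)"
      have "C\<^sup>2 + S\<^sup>2 = 1" by (simp add: C_S_def)
      then have "(a\<^sup>2 + b\<^sup>2) / 2 + (a\<^sup>2 - b\<^sup>2) / 2 * (C\<^sup>2 - S\<^sup>2) + a * b * (2 * S * C) = (a * C + b * S)\<^sup>2"
        by algebra
      then show ?thesis
        by (simp add: inner_complex_def cos_double sin_double C_S_def a_b_def)
    qed
    finally show ?thesis by (simp add: has_real_derivative_iff_has_vector_derivative)
  qed
  then have "((\<lambda>s. (x \<bullet> cis (real n * s))\<^sup>2) has_integral A (2 * pi) - A 0) {0..2 * pi}"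
    by (intro fundamental_theorem_of_calculus) auto
  moreover have "A (2 * pi) - A 0 = pi * (norm x)\<^sup>2"
  proof -
    have "sin (2 * (real n * (2 * pi))) = 0" "cos (2 * (real n * (2 * pi))) = 1"
      using sin.plus_of_nat[of "0 :: real" "2 * n"] cos.plus_of_nat[of "0 :: real" "2 * n"]
      by (simp_all add: mult_ac)
    then show ?thesis by (simp add: A_def cmod_power2 a_b_def algebra_simps)
  qed
  ultimately show ?thesis by simp
qed

text \<open>If \<open>p\<close> has modulus at least \<open>M + K\<close>, then \<open>q\<close>
  lies beyond \<open>M\<close> on the same side as \<open>p\<close>, whence \<open>g q * p\<close>
  is at least \<open>c * \<bar>p\<bar>\<close>. Otherwise both \<open>c * \<bar>p\<bar>\<close> and
  the modulus of \<open>g q * p\<close> are absorbed by the subtracted constant. Replacing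
  \<open>\<bar>p\<bar>\<close> by the smaller \<open>p\<^sup>2 / R\<close> gives a bound whose
  integral is explicit when \<open>p\<close> is a sinusoid.\<close>

lemma sign_condition_lower_bound:
  fixes g :: "real \<Rightarrow> real"
  assumes G: "\<And>u. \<bar>g u\<bar> \<le> G" and pos: "\<And>u. u \<ge> M \<Longrightarrow> g u \<ge> c" and neg: "\<And>u. u \<le> - M \<Longrightarrow> g u \<le> - c"
    and "c > 0" "M \<ge> 0" "\<bar>q - p\<bar> \<le> K" "\<bar>p\<bar> \<le> R" "R > 0"
  shows "c / R * p\<^sup>2 - (c + G) * (M + K) \<le> g q * p"
proof -
  have "p\<^sup>2 \<le> R * \<bar>p\<bar>"
    using mult_right_mono[OF \<open>\<bar>p\<bar> \<le> R\<close>, of "\<bar>p\<bar>"] by (simp add: power2_eq_square)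
  then have sq: "c / R * p\<^sup>2 \<le> c * \<bar>p\<bar>"
    using \<open>c > 0\<close> \<open>R > 0\<close> by (simp add: field_simps)
  have G0: "G \<ge> 0" and K0: "K \<ge> 0" using G[of 0] \<open>\<bar>q - p\<bar> \<le> K\<close> by linarith+
  show ?thesis
  proof (cases "\<bar>p\<bar> \<ge> M + K")
    case True
    have "c * \<bar>p\<bar> \<le> g q * p"
    proof (cases "p \<ge> 0")
      case True
      with \<open>\<bar>p\<bar> \<ge> M + K\<close> \<open>\<bar>q - p\<bar> \<le> K\<close> have "q \<ge> M" by linarith
      with pos True show ?thesis by (simp add: mult_right_mono)
    next
      case False
      with \<open>\<bar>p\<bar> \<ge> M + K\<close> \<open>\<bar>q - p\<bar> \<le> K\<close> have "q \<le> - M" by linarith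
      with neg[of q] False mult_right_mono_neg[of "g q" "- c" p] show ?thesis by simp
    qed
    moreover have "0 \<le> (c + G) * (M + K)" using G0 K0 \<open>c > 0\<close> \<open>M \<ge> 0\<close> by simp
    ultimately show ?thesis using sq by linarith
  next
    case False
    have "\<bar>g q * p\<bar> \<le> G * (M + K)"
      unfolding abs_mult using G[of q] False G0 by (intro mult_mono) auto
    moreover have "c * \<bar>p\<bar> \<le> c * (M + K)" using False \<open>c > 0\<close> by simp
    ultimately show ?thesis using sq by (simp add: distrib_right)
  qed
qed

section \<open>The resonant oscillator\<close>

theorem theorem5p1:
  fixes n :: nat and g e :: "real \<Rightarrow> real"
  assumes "n \<ge> 1"
    and "continuous_on UNIV g"
    and "bounded (range g)"
    and "\<And>u. u \<noteq> 0 \<Longrightarrow> u * g u > 0"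
    and "Liminf at_top (\<lambda>u. ereal (g u)) > 0"
    and "Limsup at_bot (\<lambda>u. ereal (g u)) < 0"
    and "continuous_on UNIV e"
    and "periodic_fun_simple e (2 * pi)"
    and "integral {0..2 * pi} (\<lambda>t. e t * sin (real n * t)) = 0"
    and "integral {0..2 * pi} (\<lambda>t. e t * cos (real n * t)) = 0"
  shows "\<exists>u u' u'' :: real \<Rightarrow> real.
           periodic_fun_simple u (2 * pi) \<and>
           (\<forall>t. (u has_real_derivative u' t) (at t)) \<and>
           (\<forall>t. (u' has_real_derivative u'' t) (at t)) \<and>
           (\<forall>t. u'' t + (real n)\<^sup>2 * u t + g (u t) = e t)"
proof -
  define w where "w t = cis (real n * t)" for t
  \<comment> \<open>The direction i w is orthogonal to w, so moving \<open>z\<close> along it adds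
    nothing to the first derivative of \<open>z \<bullet> w t\<close> and contributes exactly
    \<open>e t - g (z \<bullet> w t)\<close> to the second.\<close>
  define F where "F t z = ((e t - g (z \<bullet> w t)) / real n) *\<^sub>R (\<i> * w t)" for t z
  have n: "real n > 0" using assms(1) by simp
  have norm_w: "norm (w t) = 1" for t by (simp add: w_def)
  have per_w: "w (t + 2 * pi) = w t" for t
    using sin.plus_of_nat[of "real n * t" n] cos.plus_of_nat[of "real n * t" n]
    by (simp add: w_def complex_eq_iff distrib_left mult_ac)
  have cont_w: "continuous_on S w" for S
    unfolding w_def by (intro continuous_intros)
  note cont_g = continuous_on_compose2[OF assms(2)] and cont_e = continuous_on_subset[OF assms(7)]

  obtain G where G: "\<And>u. \<bar>g u\<bar> \<le> G"
    using assms(3) unfolding bounded_iff by auto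
  have G0: "G \<ge> 0" using G[of 0] by linarith
  have "bounded (e ` {0..2 * pi})"
    by (intro compact_imp_bounded compact_continuous_image cont_e) auto
  then obtain E where E: "\<And>t. t \<in> {0..2 * pi} \<Longrightarrow> \<bar>e t\<bar> \<le> E"
    by (metis bounded_iff imageI real_norm_def)
  \<comment> \<open>\<open>K\<close> is the speed bound for \<open>F\<close> times the period: how
    far a path can drift from its start.\<close>
  define K where "K = (E + G) / real n * (2 * pi)"

  \<comment> \<open>The lower and upper limits of \<open>g\<close> are turned into one margin
    \<open>c\<close> and one threshold \<open>M\<close> serving both ends.\<close>
  obtain c M where c: "c > 0" and M: "M \<ge> 0" and pos: "\<And>u. u \<ge> M \<Longrightarrow> g u \<ge> c"
    and neg: "\<And>u. u \<le> - M \<Longrightarrow> g u \<le> - c"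
  proof -
    obtain c1 :: real where c1: "c1 > 0" "ereal c1 < Liminf at_top (\<lambda>u. ereal (g u))"
      using ereal_dense2[OF assms(5)] by auto
    then obtain M1 where M1: "\<And>u. u \<ge> M1 \<Longrightarrow> g u > c1"
      using less_LiminfD[OF c1(2)] by (auto simp: eventually_at_top_linorder)
    obtain c2 :: real where c2: "c2 < 0" "Limsup at_bot (\<lambda>u. ereal (g u)) < ereal c2"
      using ereal_dense2[OF assms(6)] by auto
    then obtain M2 where M2: "\<And>u. u \<le> M2 \<Longrightarrow> g u < c2"
      using Limsup_lessD[OF c2(2)] by (auto simp: eventually_at_bot_linorder)
    show thesis
    proof (rule that[of "min c1 (- c2)" "max 0 (max M1 (- M2))"])
      show "min c1 (- c2) \<le> g u" if "max 0 (max M1 (- M2)) \<le> u" for u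
        using M1[of u] that by auto
      show "g u \<le> - min c1 (- c2)" if "u \<le> - max 0 (max M1 (- M2))" for u
      proof -
        have "u \<le> M2" using that by linarith
        from M2[OF this] show ?thesis by linarith
      qed
    qed (use c1 c2 in auto)
  qed
  \<comment> \<open>Chosen so that \<open>pi * c * R\<close> exceeds the error
    \<open>2 * pi * (c + G) * (M + K)\<close> by exactly \<open>pi * c\<close>; the summand 1
    supplies this excess.\<close>
  define R where "R = 2 * (c + G) * (M + K) / c + 1"
  have E0: "E \<ge> 0" using E[of 0] by auto
  have K0: "K \<ge> 0" using E0 G0 n by (simp add: K_def)
  have R: "R > 0" using c M G0 K0 by (simp add: R_def add_nonneg_pos)

  have cont_F: "continuous_on UNIV (\<lambda>(t, z). F t z)"
    unfolding F_def case_prod_unfold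
    by (intro continuous_intros cont_g continuous_on_compose2[OF assms(7)]
          continuous_on_compose2[OF cont_w[of UNIV]]) (use n in auto)
  have norm_F: "norm (F t z) \<le> (E + G) / real n" if "t \<in> {0..2 * pi}" for t z
    using E[OF that] G[of "z \<bullet> w t"] n
    by (auto simp: F_def norm_mult norm_w divide_right_mono)
  have guide: "(\<i> * integral {0..2 * pi} (\<lambda>s. F s (y s))) \<bullet> x > 0"
    if x: "norm x = R" and y: "continuous_on {0..2 * pi} y"
      and yx: "\<And>s. s \<in> {0..2 * pi} \<Longrightarrow> norm (y s - x) \<le> (E + G) / real n * (2 * pi)" for x y
  proof -
    let ?I = "{0..2 * pi}"
    have lin: "bounded_linear (\<lambda>v. (\<i> * v) \<bullet> x)"
      by (intro bounded_linear_inner_left_comp bounded_linear_mult_right)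
    have "continuous_on ?I (\<lambda>s. F s (y s))"
      by (intro continuous_on_compose2[OF cont_F, where f = "\<lambda>s. (s, _ s)", simplified]
            continuous_intros y)
    then have "(\<i> * integral ?I (\<lambda>s. F s (y s))) \<bullet> x = integral ?I (\<lambda>s. (\<i> * F s (y s)) \<bullet> x)"
      using integral_linear[OF integrable_continuous_real lin] by (simp add: o_def)
    \<comment> \<open>Multiplication by i turns i w into -w, so the \<open>g\<close> term acquires a
      positive sign. The \<open>e\<close> term then vanishes, as \<open>x \<bullet> w s\<close> is a
      combination of the cosine and sine to which \<open>e\<close> is orthogonal.\<close>
    also have "(\<lambda>s. (\<i> * F s (y s)) \<bullet> x)
        = (\<lambda>s. (g (y s \<bullet> w s) * (x \<bullet> w s) - e s * (x \<bullet> w s)) / real n)"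
      by (simp add: F_def inner_commute[of x] algebra_simps diff_divide_distrib)
    also have "integral ?I \<dots> = (integral ?I (\<lambda>s. g (y s \<bullet> w s) * (x \<bullet> w s))
        - integral ?I (\<lambda>s. e s * (x \<bullet> w s))) / real n"
      by (subst integral_divide, subst Henstock_Kurzweil_Integration.integral_diff)
         (auto intro!: integrable_continuous_real continuous_intros cont_g cont_e cont_w y)
    also have "integral ?I (\<lambda>s. e s * (x \<bullet> w s))
        = integral ?I (\<lambda>s. Re x * (e s * cos (real n * s)) + Im x * (e s * sin (real n * s)))"
      by (simp add: w_def inner_complex_def algebra_simps)
    also have "\<dots> = Re x * integral ?I (\<lambda>s. e s * cos (real n * s))
        + Im x * integral ?I (\<lambda>s. e s * sin (real n * s))"
      by (subst Henstock_Kurzweil_Integration.integral_add)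
         (auto intro!: integrable_continuous_real continuous_intros cont_e)
    also have "\<dots> = 0" using assms(9,10) by simp
    finally have eq: "(\<i> * integral ?I (\<lambda>s. F s (y s))) \<bullet> x
        = integral ?I (\<lambda>s. g (y s \<bullet> w s) * (x \<bullet> w s)) / real n" by simp
    \<comment> \<open>The pointwise bound is integrated with \<open>p = x \<bullet> w s\<close> and
      \<open>q = y s \<bullet> w s\<close>; these differ by at most \<open>K\<close>, since
      \<open>w s\<close> has norm 1.\<close>
    have "((\<lambda>s. c / R * (x \<bullet> w s)\<^sup>2 - (c + G) * (M + K)) has_integral
        c / R * (pi * R\<^sup>2) - (2 * pi) * ((c + G) * (M + K))) ?I"
      using has_integral_diff[OF has_integral_mult_right[OF has_integral_sinusoid_square[OF assms(1), of x], of "c / R"]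
          has_integral_const_real[of "(c + G) * (M + K)" 0 "2 * pi"]]
      by (simp add: x w_def)
    moreover have "((\<lambda>s. g (y s \<bullet> w s) * (x \<bullet> w s)) has_integral
        integral ?I (\<lambda>s. g (y s \<bullet> w s) * (x \<bullet> w s))) ?I"
      by (intro integrable_integral integrable_continuous_real continuous_intros cont_g cont_w y) auto
    moreover have "c / R * (x \<bullet> w s)\<^sup>2 - (c + G) * (M + K) \<le> g (y s \<bullet> w s) * (x \<bullet> w s)"
      if "s \<in> ?I" for s
    proof (rule sign_condition_lower_bound[OF G pos neg c M _ _ R])
      show "\<bar>x \<bullet> w s\<bar> \<le> R" using Cauchy_Schwarz_ineq2[of x "w s"] by (simp add: norm_w x)
      show "\<bar>y s \<bullet> w s - x \<bullet> w s\<bar> \<le> K"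
        using Cauchy_Schwarz_ineq2[of "y s - x" "w s"] yx[OF that]
        by (simp add: norm_w inner_diff_left K_def)
    qed
    ultimately have "c / R * (pi * R\<^sup>2) - (2 * pi) * ((c + G) * (M + K))
        \<le> integral ?I (\<lambda>s. g (y s \<bullet> w s) * (x \<bullet> w s))"
      by (rule has_integral_le)
    moreover have "c / R * (pi * R\<^sup>2) - (2 * pi) * ((c + G) * (M + K)) = pi * c"
    proof -
      have "c * R = 2 * ((c + G) * (M + K)) + c" using c by (simp add: R_def field_simps)
      moreover have "c / R * (pi * R\<^sup>2) = pi * (c * R)" using R by (simp add: power2_eq_square)
      ultimately show ?thesis by (simp add: distrib_left)
    qed
    ultimately have "0 < integral ?I (\<lambda>s. g (y s \<bullet> w s) * (x \<bullet> w s))"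
      using mult_pos_pos[OF pi_gt_zero c] by linarith
    then show ?thesis unfolding eq using n by (rule divide_pos_pos)
  qed
  have "\<exists>z. continuous_on {0..2 * pi} z \<and> z (2 * pi) = z 0 \<and>
      (\<forall>t\<in>{0..2 * pi}. z t = z 0 + integral {0..t} (\<lambda>s. F s (z s)))" (is "\<exists>z. ?solves z")
  proof (rule boundary_value_solution[of F "2 * pi" "(E + G) / real n" R "\<lambda>v. \<i> * v"])
    show "bounded_linear (\<lambda>v. \<i> * v)" by (rule bounded_linear_mult_right)
    show "0 < 2 * pi" by simp
    show "v = 0" if "\<i> * v = 0" for v using that by simp
    fix z
    assume "continuous_on {0..2 * pi} z" "z (2 * pi) = z 0"
      "\<And>t. t \<in> {0..2 * pi} \<Longrightarrow> z t = z 0 + integral {0..t} (\<lambda>s. F s (z s))"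
    then show "\<exists>z. ?solves z" by blast
  qed (fact cont_F norm_F guide R)+
  then obtain z where z: "continuous_on {0..2 * pi} z" "z (2 * pi) = z 0"
    and z_eq: "\<And>t. t \<in> {0..2 * pi} \<Longrightarrow> z t = z 0 + integral {0..t} (\<lambda>s. F s (z s))"
    by blast
  have der_z: "(z has_vector_derivative F t (z t)) (at t within {0..2 * pi})"
    if t: "t \<in> {0..2 * pi}" for t
  proof -
    have "continuous_on {0..2 * pi} (\<lambda>s. F s (z s))"
      by (intro continuous_on_compose2[OF cont_F, where f = "\<lambda>s. (s, _ s)", simplified]
            continuous_intros z)
    from integral_has_vector_derivative[OF this t]
    have "((\<lambda>t. z 0 + integral {0..t} (\<lambda>s. F s (z s))) has_vector_derivative F t (z t))
        (at t within {0..2 * pi})"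
      by (auto intro!: derivative_eq_intros)
    then show ?thesis
      by (rule has_vector_derivative_transform[OF t, rotated]) (simp flip: z_eq)
  qed
  have per_F: "F (t + 2 * pi) = F t" for t
    using periodic_fun_simple.plus_period[OF assms(8)] by (simp add: F_def per_w fun_eq_iff)
  obtain Z where Z: "\<And>t. (Z has_vector_derivative F t (Z t)) (at t)" and per_Z: "\<And>t. Z (t + 2 * pi) = Z t"
    using periodic_extension_of_solution[of "2 * pi" F z, OF _ per_F z(2) der_z] by auto

  define f where "f t = e t - g (Z t \<bullet> w t)" for t
  have der_Re: "((\<lambda>t. Re (Z t)) has_real_derivative - (f t * sin (real n * t)) / real n) (at t)"
   and der_Im: "((\<lambda>t. Im (Z t)) has_real_derivative f t * cos (real n * t) / real n) (at t)" for t
    using Z[of t] by (simp_all add: has_vector_derivative_complex_iff F_def f_def w_def)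
  let ?u = "\<lambda>t. Re (Z t) * cos (real n * t) + Im (Z t) * sin (real n * t)"
  let ?u' = "\<lambda>t. real n * (Im (Z t) * cos (real n * t) - Re (Z t) * sin (real n * t))"
  have u: "?u t = Z t \<bullet> w t" for t by (simp add: w_def inner_complex_def)
  \<comment> \<open>The left side has the shape in which the product rule delivers the second
    derivative, with \<open>C\<close> and \<open>S\<close> for cosine and sine; with plain variables
    the identity is pure field algebra.\<close>
  have rotation_identity: "m * (d * C / m * C - Y * (S * m) - (- (d * S) / m * S + X * (C * m)))
      = d * (S\<^sup>2 + C\<^sup>2) - m\<^sup>2 * (X * C + Y * S)" if "m > 0" for m d C S X Y :: real
    using that by (simp add: field_simps power2_eq_square)
  show ?thesis
  proof (intro exI conjI allI)
    show "periodic_fun_simple ?u (2 * pi)"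
      unfolding u by standard (simp only: per_Z per_w)
    show "(?u has_real_derivative ?u' t) (at t)" for t
      by (rule derivative_eq_intros der_Re der_Im refl | simp)+ (use n in \<open>simp add: field_simps\<close>)
    show "(?u' has_real_derivative f t - (real n)\<^sup>2 * ?u t) (at t)" for t
    proof -
      have "(?u' has_real_derivative real n * (f t * cos (real n * t) / real n * cos (real n * t)
          - Im (Z t) * (sin (real n * t) * real n)
          - (- (f t * sin (real n * t)) / real n * sin (real n * t)
             + Re (Z t) * (cos (real n * t) * real n)))) (at t)"
        by (rule derivative_eq_intros der_Re der_Im refl | simp)+
      also have "real n * (f t * cos (real n * t) / real n * cos (real n * t)
          - Im (Z t) * (sin (real n * t) * real n)
          - (- (f t * sin (real n * t)) / real n * sin (real n * t)
             + Re (Z t) * (cos (real n * t) * real n))) 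
        = f t * ((sin (real n * t))\<^sup>2 + (cos (real n * t))\<^sup>2) - (real n)\<^sup>2 * ?u t"
        by (rule rotation_identity[OF n])
      also have "\<dots> = f t - (real n)\<^sup>2 * ?u t" by simp
      finally show ?thesis .
    qed
    show "f t - (real n)\<^sup>2 * ?u t + (real n)\<^sup>2 * ?u t + g (?u t) = e t" for t
      by (simp only: u f_def)
  qed
qed

end
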